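(* Let $r$ be a positive integer, let $G$ be a unicyclic graph with $\delta(G)=1$, let $n\geq 3$ be the order of the unique cycle of $G$, and let $k=\min\{r,\Delta(G)\}+1$. Then: (a) if $n\neq 5$ and $r\geq 3$, then $\chi_{L,r}(G)=k$; (b) if $n=5$ or $r=2$, then $\chi_{L,r}(G)\in\{k,k+1\}$.
   Context: All graphs are finite and simple. $\Delta(G)$ and $\delta(G)$ are the maximum and minimum degree of $G$, $d_G(v)$ the degree of $v$, and $N_G(v)$ the set of neighbors of $v$. A unicyclic graph is a connected graph $G$ with $|E(G)|=|V(G)|$ (so it contains exactly one cycle). A list of $G$ is a map $L$ assigning to each vertex $v$ a set $L(v)\subseteq\mathbb{N}$ of colors; $L$ is a $k$-list if $|L(v)|=k$ for every $v\in V(G)$. For a positive integer $r$, an $(L,r)$-coloring of $G$ is a map $c:V(G)\to\mathbb{N}$ such that (1) $c(u)\neq c(v)$ for every edge $uv\in E(G)$; (2) $|c(N_G(v))|\geq\min\{d_G(v),r\}$ for every $v\in V(G)$; (3) $c(v)\in L(v)$ for every $v\in V(G)$. The list $r$-hued chromatic number $\chi_{L,r}(G)$ is the smallest integer $k$ such that for every $k$-list $L$ of $G$, $G$ has an $(L,r)$-coloring. *)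

theory Defs
  imports Main
begin

text \<open>A graph is given by its vertex set \<open>V\<close> and its edge set \<open>E\<close>, whose members are
  two-element subsets of \<open>V\<close>.\<close>

definition simple_graph :: "'a set \<Rightarrow> 'a set set \<Rightarrow> bool" where
  "simple_graph V E \<longleftrightarrow> finite V \<and> (\<forall>e\<in>E. e \<subseteq> V \<and> card e = 2)"

definition neighbors :: "'a set set \<Rightarrow> 'a \<Rightarrow> 'a set" where
  "neighbors E v = {u. {u, v} \<in> E}"

definition degree :: "'a set set \<Rightarrow> 'a \<Rightarrow> nat" where
  "degree E v = card (neighbors E v)"

definition max_degree :: "'a set \<Rightarrow> 'a set set \<Rightarrow> nat" where
  "max_degree V E = Max (degree E ` V)"

definition min_degree :: "'a set \<Rightarrow> 'a set set \<Rightarrow> nat" where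
  "min_degree V E = Min (degree E ` V)"

definition connected_graph :: "'a set \<Rightarrow> 'a set set \<Rightarrow> bool" where
  "connected_graph V E \<longleftrightarrow>
     V \<noteq> {} \<and> (\<forall>u\<in>V. \<forall>v\<in>V. (u, v) \<in> {(x, y). {x, y} \<in> E}\<^sup>*)"

definition unicyclic :: "'a set \<Rightarrow> 'a set set \<Rightarrow> bool" where
  "unicyclic V E \<longleftrightarrow> simple_graph V E \<and> connected_graph V E \<and> card E = card V"

text \<open>A cycle is represented by the list of its vertices in cyclic order, so that its order
  is the length of the list; rotations and reversals of the list represent the same cycle.\<close>

definition is_cycle :: "'a set \<Rightarrow> 'a set set \<Rightarrow> 'a list \<Rightarrow> bool" where
  "is_cycle V E p \<longleftrightarrow> 3 \<le> length p \<and> distinct p \<and> set p \<subseteq> V \<and>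
     (\<forall>i < length p. {p ! i, p ! (Suc i mod length p)} \<in> E)"

text \<open>Finiteness matters only for \<open>k = 0\<close>, because the cardinality of an infinite set is \<open>0\<close>.\<close>

definition k_list :: "'a set \<Rightarrow> nat \<Rightarrow> ('a \<Rightarrow> nat set) \<Rightarrow> bool" where
  "k_list V k L \<longleftrightarrow> (\<forall>v\<in>V. finite (L v) \<and> card (L v) = k)"

definition hued_list_coloring ::
  "'a set \<Rightarrow> 'a set set \<Rightarrow> ('a \<Rightarrow> nat set) \<Rightarrow> nat \<Rightarrow> ('a \<Rightarrow> nat) \<Rightarrow> bool" where
  "hued_list_coloring V E L r c \<longleftrightarrow>
     (\<forall>u v. {u, v} \<in> E \<longrightarrow> c u \<noteq> c v) \<and>
     (\<forall>v\<in>V. card (c ` neighbors E v) \<ge> min (degree E v) r) \<and>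
     (\<forall>v\<in>V. c v \<in> L v)"

definition list_hued_chromatic_number :: "'a set \<Rightarrow> 'a set set \<Rightarrow> nat \<Rightarrow> nat" where
  "list_hued_chromatic_number V E r =
     (LEAST k. \<forall>L. k_list V k L \<longrightarrow> (\<exists>c. hued_list_coloring V E L r c))"

end

theory Submission
  imports Defs
begin

text \<open>In a unicyclic graph every vertex set \<open>S\<close> containing the cycle and grown from it one adjacent
  vertex at a time induces exactly \<open>|S|\<close> edges, so each new vertex hangs on a single vertex of \<open>S\<close>.
  A colouring of the cycle therefore extends greedily: a new vertex avoids the colour of its
  neighbour \<open>w\<close> and, while \<open>w\<close> sees fewer than \<open>r\<close> colours, also those colours, at most
  \<open>min r \<Delta>\<close> in total.

  It remains to colour the cycle. Its square is 4-choosable unless \<open>n = 5\<close>, by a Brooks-type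
  argument; five colours suffice when \<open>n = 5\<close>. For \<open>r = 2\<close>, a cycle vertex with a neighbour
  off the cycle allows one edge of the square to be dropped, after which four colours suffice.\<close>

section \<open>Edge counts of vertex sets in unicyclic graphs\<close>

definition induced_edges :: "'a set set \<Rightarrow> 'a set \<Rightarrow> 'a set set" where
  "induced_edges E S = {e \<in> E. e \<subseteq> S}"

lemma simple_graph_finite_edges:
  assumes "simple_graph V E"
  shows "finite E"
proof -
  have "E \<subseteq> Pow V" "finite V" using assms by (auto simp: simple_graph_def)
  then show ?thesis by (meson finite_Pow_iff finite_subset)
qed

lemma simple_graph_edgeD:
  assumes "simple_graph V E" "{u, v} \<in> E"
  shows "u \<in> V" "v \<in> V" "u \<noteq> v"
proof -
  have "{u, v} \<subseteq> V" "card {u, v} = 2" using assms by (auto simp: simple_graph_def)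
  then show "u \<in> V" "v \<in> V" "u \<noteq> v" by auto
qed

lemma neighbors_subset:
  assumes "simple_graph V E"
  shows "neighbors E v \<subseteq> V"
  using simple_graph_edgeD[OF assms] by (auto simp: neighbors_def)

lemma finite_neighbors:
  assumes "simple_graph V E"
  shows "finite (neighbors E v)"
  using neighbors_subset[OF assms] assms by (meson finite_subset simple_graph_def)

lemma finite_induced_edges:
  assumes "simple_graph V E"
  shows "finite (induced_edges E S)"
  using simple_graph_finite_edges[OF assms] by (simp add: induced_edges_def)

text \<open>A walk from \<open>S\<close> to a vertex outside must use an edge leaving
  \<open>S\<close>. This supplies the next vertex whenever a set is grown.\<close>

lemma connected_graph_boundary:
  assumes "simple_graph V E" "connected_graph V E" "S \<subset> V" "S \<noteq> {}"
  obtains w x where "w \<in> S" "x \<in> V - S" "{w, x} \<in> E"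
proof (rule ccontr)
  assume none: "\<not> thesis"
  obtain s t where s: "s \<in> S" and t: "t \<in> V - S" using assms by blast
  have "(s, t) \<in> {(x, y). {x, y} \<in> E}\<^sup>*"
    using assms s t by (auto simp: connected_graph_def)
  then have "t \<in> S"
  proof (induction rule: rtrancl_induct)
    case base
    show ?case by (rule s)
  next
    case (step y z)
    then have "{y, z} \<in> E" by simp
    then have "z \<in> V" by (rule simple_graph_edgeD(2)[OF assms(1)])
    then show ?case using that[of y z] none \<open>{y, z} \<in> E\<close> step.IH by auto
  qed
  with t show False by simp
qed

text \<open>Growing \<open>S\<close> to \<open>V\<close> along boundary edges, each new vertex
  brings at least one edge that was not induced before.\<close>

lemma card_induced_edges_le:
  assumes "simple_graph V E" "connected_graph V E" "S \<subseteq> V" "S \<noteq> {}"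
  shows "card (induced_edges E S) + card (V - S) \<le> card E"
  using assms(3,4)
proof (induction "card (V - S)" arbitrary: S)
  case 0
  have "induced_edges E S \<subseteq> E" by (auto simp: induced_edges_def)
  then show ?case using 0 simple_graph_finite_edges[OF assms(1)] by (simp add: card_mono)
next
  case (Suc m)
  have finV: "finite V" using assms(1) by (simp add: simple_graph_def)
  have "S \<subset> V" using Suc.hyps(2) Suc.prems(1) by auto
  from connected_graph_boundary[OF assms(1,2) this Suc.prems(2)]
  obtain w x where wx: "w \<in> S" "x \<in> V - S" "{w, x} \<in> E" by blast
  have m: "m = card (V - insert x S)" using Suc.hyps(2) wx by simp
  have "insert {w, x} (induced_edges E S) \<subseteq> induced_edges E (insert x S)"
    "{w, x} \<notin> induced_edges E S"
    using wx by (auto simp: induced_edges_def)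
  then have "Suc (card (induced_edges E S)) \<le> card (induced_edges E (insert x S))"
    using card_mono[OF finite_induced_edges[OF assms(1)], of "insert {w, x} (induced_edges E S)"]
      finite_induced_edges[OF assms(1), of S] by simp
  moreover have "card (induced_edges E (insert x S)) + m \<le> card E"
    unfolding m using Suc.prems wx by (intro Suc.hyps(1)[OF m]) auto
  ultimately show ?case using Suc.hyps(2) by linarith
qed

lemma unicyclic_card_induced_edges_le:
  assumes "unicyclic V E" "S \<subseteq> V" "S \<noteq> {}"
  shows "card (induced_edges E S) \<le> card S"
proof -
  have "finite V" using assms by (auto simp: unicyclic_def simple_graph_def)
  then have "card V = card S + card (V - S)"
    using assms by (metis card_Diff_subset card_mono finite_subset le_add_diff_inverse)
  then show ?thesis
    using assms card_induced_edges_le[of V E S] by (simp add: unicyclic_def)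
qed

text \<open>Two edges from \<open>x\<close> into \<open>S\<close> would give
  \<open>insert x S\<close> at least \<open>card S + 2\<close> edges on \<open>card S + 1\<close>
  vertices, contradicting the edge bound for unicyclic graphs.\<close>

lemma unicyclic_unique_attachment:
  assumes "unicyclic V E" "S \<subseteq> V" "card S \<le> card (induced_edges E S)"
    and "x \<in> V - S" "w \<in> S" "w' \<in> S" "{w, x} \<in> E" "{w', x} \<in> E"
  shows "w = w'"
proof (rule ccontr)
  assume "w \<noteq> w'"
  have simple: "simple_graph V E" using assms by (simp add: unicyclic_def)
  let ?I = "induced_edges E S"
  have "insert {w, x} (insert {w', x} ?I) \<subseteq> induced_edges E (insert x S)"
    using assms by (auto simp: induced_edges_def)
  moreover have "{w, x} \<notin> insert {w', x} ?I" "{w', x} \<notin> ?I"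
    using assms \<open>w \<noteq> w'\<close> by (auto simp: induced_edges_def doubleton_eq_iff)
  moreover have "finite ?I" by (rule finite_induced_edges[OF simple])
  ultimately have "card ?I + 2 \<le> card (induced_edges E (insert x S))"
    using card_mono[OF finite_induced_edges[OF simple], of "insert {w, x} (insert {w', x} ?I)"]
    by simp
  also have "\<dots> \<le> card (insert x S)"
    using assms by (intro unicyclic_card_induced_edges_le[OF assms(1)]) auto
  also have "\<dots> \<le> Suc (card S)" by (rule card_insert_le_m1) simp_all
  finally show False using assms(3) by simp
qed

section \<open>Completing a partial colouring vertex by vertex\<close>

text \<open>A colouring of \<open>S\<close> that can still be completed one vertex at a time: at every vertex the
  colours seen so far, together with the uncoloured neighbours, are enough for the hue condition.\<close>

definition extendable ::
  "'a set set \<Rightarrow> ('a \<Rightarrow> nat set) \<Rightarrow> nat \<Rightarrow> 'a set \<Rightarrow> ('a \<Rightarrow> nat) \<Rightarrow> bool" where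
  "extendable E L r S c \<longleftrightarrow>
     (\<forall>u\<in>S. \<forall>v\<in>S. {u, v} \<in> E \<longrightarrow> c u \<noteq> c v) \<and>
     (\<forall>v\<in>S. min (degree E v) r \<le> card (c ` (neighbors E v \<inter> S)) + card (neighbors E v - S)) \<and>
     (\<forall>v\<in>S. c v \<in> L v)"

lemma degree_le_max_degree:
  assumes "simple_graph V E" "v \<in> V"
  shows "degree E v \<le> max_degree V E"
  using assms by (auto simp: max_degree_def simple_graph_def)

text \<open>The only coloured neighbour of \<open>x\<close> is \<open>w\<close>, so the new colour
  affects the conditions at \<open>w\<close> and \<open>x\<close> alone. At most
  \<open>min r \<Delta>\<close> colours are forbidden, fewer than the \<open>K\<close> in the
  list.\<close>

lemma extendable_insert:
  assumes uni: "unicyclic V E" and SV: "S \<subseteq> V" and card: "card S \<le> card (induced_edges E S)"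
    and r: "r \<ge> 1" and L: "k_list V K L" and K: "min r (max_degree V E) < K"
    and c: "extendable E L r S c"
    and x: "x \<in> V - S" and w: "w \<in> S" and wx: "{w, x} \<in> E"
  shows "\<exists>c'. extendable E L r (insert x S) c'"
proof -
  let ?N = "neighbors E"
  have simple: "simple_graph V E" using uni by (simp add: unicyclic_def)
  note fin = finite_neighbors[OF simple]
  have attach: "v = w" if "v \<in> S" "{v, x} \<in> E" for v
    using unicyclic_unique_attachment[OF uni SV card x that(1) w that(2) wx] .
  \<comment> \<open>Once \<open>w\<close> sees \<open>r\<close> colours its hue condition is settled
    and only the colour of \<open>w\<close> itself stays forbidden.\<close>
  define D where "D = (if card (c ` (?N w \<inter> S)) < r then c ` (?N w \<inter> S) else {})"
  have finD: "finite D" using fin by (simp add: D_def)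
  have xN: "x \<in> ?N w" using wx by (simp add: neighbors_def insert_commute)
  have wV: "w \<in> V" using w SV by auto
  \<comment> \<open>Strict because \<open>x\<close> is a neighbour of \<open>w\<close> that is still
    uncoloured.\<close>
  have "card (?N w \<inter> S) < degree E w"
    unfolding degree_def using xN x fin by (intro psubset_card_mono) auto
  then have "card (c ` (?N w \<inter> S)) < max_degree V E"
    using degree_le_max_degree[OF simple wV] fin[of w]
    by (meson card_image_le finite_Int le_less_trans less_le_trans)
  then have "card D < min r (max_degree V E)" using r by (auto simp: D_def)
  then have "card (insert (c w) D) < K" using K finD by (auto simp: card_insert_if)
  moreover have "finite (L x)" "card (L x) = K" using L x by (auto simp: k_list_def)
  ultimately have "\<not> L x \<subseteq> insert (c w) D" using finD by (metis card_mono finite_insert leD)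
  then obtain a where a: "a \<in> L x" "a \<noteq> c w" "a \<notin> D" by auto
  let ?c = "c(x := a)"
  have img: "?c ` (?N v \<inter> S) = c ` (?N v \<inter> S)" for v using x by (intro image_cong) auto
  have "?c u \<noteq> ?c v" if "u \<in> insert x S" "v \<in> insert x S" "{u, v} \<in> E" for u v
    using that a attach[of u] attach[of v] c simple_graph_edgeD(3)[OF simple that(3)]
    by (auto simp: extendable_def insert_commute)
  moreover have "min (degree E v) r
      \<le> card (?c ` (?N v \<inter> insert x S)) + card (?N v - insert x S)" if v: "v \<in> insert x S" for v
  proof -
    consider "v = x" | "v = w" | "v \<in> S" "v \<noteq> w" using v by auto
    then show ?thesis
    proof cases
      case 1
      \<comment> \<open>All neighbours of \<open>x\<close> except \<open>w\<close> are uncoloured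
        and counted as such; the colour of \<open>w\<close> accounts for the remaining one.\<close>
      have sub: "?N x \<subseteq> insert w (?N x - insert x S)"
        using attach simple_graph_edgeD(3)[OF simple] by (auto simp: neighbors_def)
      have "w \<in> ?N x" using wx by (simp add: neighbors_def)
      then have "?c ` (?N x \<inter> insert x S) \<noteq> {}" using w by auto
      then have "1 \<le> card (?c ` (?N x \<inter> insert x S))"
        using fin by (simp add: Suc_le_eq card_gt_0_iff)
      moreover have "card (?N x) \<le> card (insert w (?N x - insert x S))"
        using fin sub by (intro card_mono) auto
      then have "degree E x \<le> Suc (card (?N x - insert x S))"
        using card_insert_le_m1[of "Suc (card (?N x - insert x S))" "?N x - insert x S" w]
        by (simp add: degree_def)
      ultimately show ?thesis using 1 by simp
    next
      case 2
      have sp: "?N w - S = insert x (?N w - insert x S)" using xN x by auto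
      have cd: "card (?N w - S) = Suc (card (?N w - insert x S))"
        using fin by (subst sp) (simp del: card_Diff_insert)
      have im: "?c ` (?N w \<inter> insert x S) = insert a (c ` (?N w \<inter> S))"
        using xN img[of w] by auto
      have inv: "min (degree E w) r \<le> card (c ` (?N w \<inter> S)) + card (?N w - S)"
        using c w by (simp add: extendable_def)
      show ?thesis
      \<comment> \<open>Colouring \<open>x\<close> takes one from the uncoloured neighbours of
        \<open>w\<close>. Below \<open>r\<close> hues the new colour differs from those seen and
        makes up for it; otherwise \<open>r\<close> hues are present already.\<close>
      proof (cases "card (c ` (?N w \<inter> S)) < r")
        case True
        then have "card (insert a (c ` (?N w \<inter> S))) = Suc (card (c ` (?N w \<inter> S)))"
          using a fin by (simp add: D_def)
        then show ?thesis using inv 2 cd im by simp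
      next
        case False
        then have "r \<le> card (insert a (c ` (?N w \<inter> S)))"
          using fin by (simp add: card_insert_if)
        then show ?thesis using 2 im by simp
      qed
    next
      case 3
      then have "x \<notin> ?N v" using attach[of v] by (auto simp: neighbors_def insert_commute)
      then have "?N v \<inter> insert x S = ?N v \<inter> S" "?N v - insert x S = ?N v - S" by auto
      then show ?thesis using img[of v] c 3 by (simp add: extendable_def)
    qed
  qed
  moreover have "?c v \<in> L v" if "v \<in> insert x S" for v
    using that a c by (auto simp: extendable_def)
  ultimately have "extendable E L r (insert x S) ?c" unfolding extendable_def by blast
  then show ?thesis by blast
qed

text \<open>Each insertion adds the edge \<open>{w, x}\<close>, so the edge count keeps up with the
  vertex count and the extension step applies again. At \<open>S = V\<close> no uncoloured
  neighbours remain and the invariant becomes the hue condition.\<close>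

lemma extendable_imp_hued_list_coloring:
  assumes uni: "unicyclic V E" and "S \<subseteq> V" "S \<noteq> {}" "card S \<le> card (induced_edges E S)"
    and r: "r \<ge> 1" and L: "k_list V K L" and K: "min r (max_degree V E) < K"
    and "extendable E L r S c"
  shows "\<exists>c. hued_list_coloring V E L r c"
  using assms(2-4,8)
proof (induction "card (V - S)" arbitrary: S c)
  case 0
  have simple: "simple_graph V E" using uni by (simp add: unicyclic_def)
  then have "finite V" by (simp add: simple_graph_def)
  with 0 have SV: "S = V" by auto
  have nb: "neighbors E v \<inter> V = neighbors E v" "card (neighbors E v - V) = 0" for v
    using neighbors_subset[OF simple, of v] by (auto simp: Int_absorb2 Diff_eq_empty_iff[THEN iffD2])
  then have "hued_list_coloring V E L r c"
    using 0 SV simple_graph_edgeD[OF simple]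
    by (simp add: extendable_def hued_list_coloring_def)
  then show ?case by blast
next
  case (Suc m)
  have simple: "simple_graph V E" and conn: "connected_graph V E"
    using uni by (simp_all add: unicyclic_def)
  have finV: "finite V" using simple by (simp add: simple_graph_def)
  have "S \<subset> V" using Suc.hyps(2) Suc.prems(1) by auto
  from connected_graph_boundary[OF simple conn this Suc.prems(2)]
  obtain w x where wx: "w \<in> S" "x \<in> V - S" "{w, x} \<in> E" by blast
  obtain c' where c': "extendable E L r (insert x S) c'"
    using extendable_insert[OF uni Suc.prems(1,3) r L K Suc.prems(4) wx(2,1,3)] by blast
  have m: "m = card (V - insert x S)" using Suc.hyps(2) wx by simp
  have "insert {w, x} (induced_edges E S) \<subseteq> induced_edges E (insert x S)"
    "{w, x} \<notin> induced_edges E S"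
    using wx by (auto simp: induced_edges_def)
  then have "Suc (card (induced_edges E S)) \<le> card (induced_edges E (insert x S))"
    using card_mono[OF finite_induced_edges[OF simple], of "insert {w, x} (induced_edges E S)"]
      finite_induced_edges[OF simple, of S] by simp
  moreover have "card (insert x S) \<le> Suc (card S)" by (rule card_insert_le_m1) simp_all
  ultimately show ?case
    using Suc.prems wx c' by (intro Suc.hyps(1)[OF m _ _ _ c']) auto
qed

section \<open>Greedy list colouring\<close>

text \<open>The relation is arbitrary so that the same greedy lemmas serve the cycle, its square,
  and the square with one edge removed.\<close>

definition proper_on :: "('b \<Rightarrow> 'b \<Rightarrow> bool) \<Rightarrow> 'b set \<Rightarrow> ('b \<Rightarrow> 'c) \<Rightarrow> bool" where
  "proper_on R S c \<longleftrightarrow> (\<forall>x\<in>S. \<forall>y\<in>S. R x y \<longrightarrow> c x \<noteq> c y)"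

text \<open>Blocked colours are counted inside \<open>A\<close> only: neighbours that share a
  colour, or use one outside \<open>A\<close>, leave room. The Brooks-type cases rely on
  this.\<close>

lemma greedy_step:
  assumes "symp R" "irreflp R" "proper_on R S c" "x \<notin> S"
    and "card (c ` {y \<in> S. R x y} \<inter> A) < card A"
  obtains a where "a \<in> A" "proper_on R (insert x S) (c(x := a))"
proof -
  have "c ` {y \<in> S. R x y} \<inter> A \<noteq> A" using assms(5) by auto
  then obtain a where a: "a \<in> A" "a \<notin> c ` {y \<in> S. R x y}" by blast
  have "proper_on R (insert x S) (c(x := a))"
    using a assms(1-4) unfolding proper_on_def
    by (auto dest: sympD irreflpD)
  then show thesis using a that by blast
qed

lemma card_image_Int_less:
  assumes "finite S" "card {y \<in> S. Q y} < card A" "finite A"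
  shows "card (c ` {y \<in> S. Q y} \<inter> A) < card A"
proof -
  have "card (c ` {y \<in> S. Q y} \<inter> A) \<le> card (c ` {y \<in> S. Q y})"
    using assms by (intro card_mono) auto
  also have "\<dots> \<le> card {y \<in> S. Q y}" using assms by (intro card_image_le) auto
  finally show ?thesis using assms by simp
qed

text \<open>The bound at \<open>x\<close> counts only vertices coloured before \<open>x\<close>,
  namely the precoloured set \<open>S\<close> and the earlier part of the interval. Choosing
  \<open>S\<close> and the interval thus fixes a degeneracy order.\<close>

lemma greedy_interval:
  fixes a b :: nat
  assumes "symp R" "irreflp R" "proper_on R S c" "finite S" "S \<inter> {a..<b} = {}" "a \<le> b"
    and "\<And>x. x \<in> {a..<b} \<Longrightarrow>
      finite (L x) \<and> card {y \<in> S \<union> {a..<x}. R x y} < card (L x)"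
  shows "\<exists>c'. (\<forall>x\<in>S. c' x = c x) \<and> (\<forall>x\<in>{a..<b}. c' x \<in> L x) \<and> proper_on R (S \<union> {a..<b}) c'"
  using assms(6,5,7)
proof (induction b rule: dec_induct)
  case base
  show ?case using assms(3) by auto
next
  case (step n)
  have "S \<inter> {a..<n} = {}" using step.prems(1) by auto
  moreover have "finite (L x) \<and> card {y \<in> S \<union> {a..<x}. R x y} < card (L x)"
    if "x \<in> {a..<n}" for x
    using that by (intro step.prems(2)) simp
  ultimately obtain c' where c': "\<forall>x\<in>S. c' x = c x" "\<forall>x\<in>{a..<n}. c' x \<in> L x"
    "proper_on R (S \<union> {a..<n}) c'"
    using step.IH by blast
  have n: "n \<notin> S \<union> {a..<n}" using step by auto
  have Ln: "finite (L n)" "card {y \<in> S \<union> {a..<n}. R n y} < card (L n)"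
    using step.prems(2)[of n] step.hyps by auto
  have "card (c' ` {y \<in> S \<union> {a..<n}. R n y} \<inter> L n) < card (L n)"
    using assms(4) by (intro card_image_Int_less Ln) simp
  from greedy_step[OF assms(1,2) c'(3) n this]
  obtain d where d: "d \<in> L n" "proper_on R (insert n (S \<union> {a..<n})) (c'(n := d))" by blast
  have "insert n (S \<union> {a..<n}) = S \<union> {a..<Suc n}" using step.hyps by auto
  then show ?case using c' d n by (intro exI[of _ "c'(n := d)"]) (auto simp del: fun_upd_apply, auto)
qed

lemma card_less_if_subset_three:
  assumes "A \<subseteq> {x, y, z}" "4 \<le> m"
  shows "card A < m"
proof -
  have "card A \<le> card {x, y, z}" using assms(1) by (intro card_mono) auto
  also have "\<dots> < m" using assms(2) by (simp add: card_insert_if)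
  finally show ?thesis .
qed

section \<open>List colourings of a cycle and its square, on indices\<close>

text \<open>Meant for indices below \<open>n\<close>. Wrap-around is written additively, without
  \<open>mod\<close> or truncated subtraction, which suits linear arithmetic;
  \<open>i \<noteq> j\<close> keeps the relation irreflexive for every \<open>n\<close>.\<close>

definition cyc_adj :: "nat \<Rightarrow> nat \<Rightarrow> nat \<Rightarrow> bool" where
  "cyc_adj n i j \<longleftrightarrow> i \<noteq> j \<and> (j = i + 1 \<or> i = j + 1 \<or> j + 1 = i + n \<or> i + 1 = j + n)"

definition sq_adj :: "nat \<Rightarrow> nat \<Rightarrow> nat \<Rightarrow> bool" where
  "sq_adj n i j \<longleftrightarrow> cyc_adj n i j \<or>
     i \<noteq> j \<and> (j = i + 2 \<or> i = j + 2 \<or> j + 2 = i + n \<or> i + 2 = j + n)"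

lemma symp_cyc_adj: "symp (cyc_adj n)" and irreflp_cyc_adj: "irreflp (cyc_adj n)"
  and symp_sq_adj: "symp (sq_adj n)" and irreflp_sq_adj: "irreflp (sq_adj n)"
  by (auto simp: symp_def irreflp_def cyc_adj_def sq_adj_def)

text \<open>This is how a proper colouring of the square yields the hue condition: the two cycle
  neighbours of a vertex get distinct colours.\<close>

lemma sq_adj_if_common_neighbor:
  assumes "cyc_adj n i a" "cyc_adj n i b" "a \<noteq> b" "i < n" "a < n" "b < n"
  shows "sq_adj n a b"
proof -
  have "b = a + 2 \<or> a = b + 2 \<or> b + 2 = a + n \<or> a + 2 = b + n"
    using assms unfolding cyc_adj_def by (elim conjE disjE) linarith+
  with assms(3) show ?thesis by (simp add: sq_adj_def)
qed

lemma list_coloring_large_lists: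
  assumes "symp R" "irreflp R" "\<And>i. i < n \<Longrightarrow> finite (L i) \<and> n \<le> card (L i)"
  shows "\<exists>c. (\<forall>i<n. c i \<in> L i) \<and> proper_on R {..<n} c"
proof -
  have "card {y \<in> {} \<union> {0..<x}. R x y} < card (L x)" if "x < n" for x
  proof -
    have "card {y \<in> {} \<union> {0..<x}. R x y} \<le> card {0..<x}" by (rule card_mono) auto
    also have "\<dots> < card (L x)" using assms(3)[OF that] that by simp
    finally show ?thesis .
  qed
  then have "\<exists>c'. (\<forall>x\<in>{}. c' x = undefined x) \<and> (\<forall>x\<in>{0..<n}. c' x \<in> L x) \<and>
      proper_on R ({} \<union> {0..<n}) c'"
    using assms by (intro greedy_interval) (auto simp: proper_on_def)
  then show ?thesis by (auto simp: atLeast0LessThan)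
qed

lemma cycle_three_list_coloring:
  assumes "\<And>i. i < n \<Longrightarrow> finite (L i) \<and> 3 \<le> card (L i)"
  shows "\<exists>c. (\<forall>i<n. c i \<in> L i) \<and> proper_on (cyc_adj n) {..<n} c"
proof -
  have "card {y \<in> {} \<union> {0..<x}. cyc_adj n x y} < card (L x)" if "x < n" for x
  proof -
    \<comment> \<open>For \<open>x < n\<close> the truncated \<open>x + 1 - n\<close> is
      \<open>0\<close>, the wrap-around neighbour of the last vertex.\<close>
    have "card {y \<in> {} \<union> {0..<x}. cyc_adj n x y} \<le> card {x - 1, x + 1 - n}"
      by (rule card_mono) (auto simp: cyc_adj_def)
    also have "\<dots> \<le> 2" by (simp add: card_insert_if)
    finally show ?thesis using assms[OF that] by simp
  qed
  then have "\<exists>c'. (\<forall>x\<in>{}. c' x = undefined x) \<and> (\<forall>x\<in>{0..<n}. c' x \<in> L x) \<and>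
      proper_on (cyc_adj n) ({} \<union> {0..<n}) c'"
    using assms by (intro greedy_interval symp_cyc_adj irreflp_cyc_adj) (auto simp: proper_on_def)
  then show ?thesis by (auto simp: atLeast0LessThan)
qed

text \<open>The square of the cycle without the edge between the two neighbours of the last vertex
  is 3-degenerate.\<close>

lemma relaxed_four_list_coloring:
  assumes n: "n \<ge> 5" and L: "\<And>i. i < n \<Longrightarrow> finite (L i) \<and> 4 \<le> card (L i)"
  shows "\<exists>c. (\<forall>i<n. c i \<in> L i) \<and>
    proper_on (\<lambda>i j. sq_adj n i j \<and> {i, j} \<noteq> {0, n - 2}) {..<n} c"
proof -
  define R where "R = (\<lambda>i j. sq_adj n i j \<and> {i, j} \<noteq> {0, n - 2})"
  have R: "symp R" "irreflp R"
    using symp_sq_adj[of n] irreflp_sq_adj[of n]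
    by (auto simp: R_def symp_def irreflp_def insert_commute)
  have "card {y \<in> {} \<union> {1..<x}. R x y} < card (L x)" if "x < n" for x
  proof -
    \<comment> \<open>The order is \<open>1, ..., n - 1\<close>, then \<open>0\<close>. The term
      \<open>x + 2 - n\<close> is positive only for \<open>x = n - 1\<close>, where it is the
      wrap-around neighbour \<open>1\<close>.\<close>
    have "{y \<in> {} \<union> {1..<x}. R x y} \<subseteq> {x - 1, x - 2, x + 2 - n}"
      using that by (auto simp: R_def sq_adj_def cyc_adj_def)
    then show ?thesis by (rule card_less_if_subset_three) (use L[of x] that in auto)
  qed
  then have "\<exists>c'. (\<forall>x\<in>{}. c' x = undefined x) \<and> (\<forall>x\<in>{1..<n}. c' x \<in> L x) \<and>
      proper_on R ({} \<union> {1..<n}) c'"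
    using L n by (intro greedy_interval R) (auto simp: proper_on_def)
  then obtain c where c: "\<forall>x\<in>{1..<n}. c x \<in> L x" "proper_on R {1..<n} c" by auto
  \<comment> \<open>The removed edge is the one to \<open>n - 2\<close>, the fourth neighbour of
    \<open>0\<close> in the square.\<close>
  have "{y \<in> {1..<n}. R 0 y} \<subseteq> {1, 2, n - 1}"
    by (auto simp: R_def sq_adj_def cyc_adj_def)
  then have "card {y \<in> {1..<n}. R 0 y} < card (L 0)"
    by (rule card_less_if_subset_three) (use L[of 0] n in auto)
  then have "card (c ` {y \<in> {1..<n}. R 0 y} \<inter> L 0) < card (L 0)"
    using L[of 0] n by (intro card_image_Int_less) auto
  moreover have "0 \<notin> {1..<n}" by simp
  ultimately obtain a where "a \<in> L 0" "proper_on R (insert 0 {1..<n}) (c(0 := a))"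
    using greedy_step[OF R c(2)] by blast
  moreover have "insert 0 {1..<n} = {..<n}" using n by auto
  ultimately show ?thesis using c(1) unfolding R_def by (intro exI[of _ "c(0 := a)"]) auto
qed

text \<open>Give the last vertex a colour \<open>d\<close> outside \<open>L 0\<close>, then colour
  \<open>1, ..., n - 2\<close> in order and \<open>0\<close> at the end. All four neighbours of
  \<open>0\<close> are coloured by then, but \<open>d\<close> blocks nothing in
  \<open>L 0\<close>.\<close>

lemma square_list_coloring_if_lists_differ:
  assumes n: "n \<ge> 6" and L: "\<And>i. i < n \<Longrightarrow> finite (L i) \<and> 4 \<le> card (L i)"
    and d: "\<not> L (n - 1) \<subseteq> L 0"
  shows "\<exists>c. (\<forall>i<n. c i \<in> L i) \<and> proper_on (sq_adj n) {..<n} c"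
proof -
  note R = symp_sq_adj[of n] irreflp_sq_adj[of n]
  obtain d where d: "d \<in> L (n - 1)" "d \<notin> L 0" using assms by blast
  have "card {y \<in> {n - 1} \<union> {1..<x}. sq_adj n x y} < card (L x)" if "x < n - 1" for x
  proof -
    have "{y \<in> {n - 1} \<union> {1..<x}. sq_adj n x y} \<subseteq> {x - 1, x - 2, n - 1}"
      using that by (auto simp: sq_adj_def cyc_adj_def)
    then show ?thesis by (rule card_less_if_subset_three) (use L[of x] that in auto)
  qed
  then have "\<exists>c'. (\<forall>x\<in>{n - 1}. c' x = d) \<and> (\<forall>x\<in>{1..<n - 1}. c' x \<in> L x) \<and>
      proper_on (sq_adj n) ({n - 1} \<union> {1..<n - 1}) c'"
    using L n R(2) by (intro greedy_interval R) (auto simp: proper_on_def irreflp_def)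
  moreover have "{n - 1} \<union> {1..<n - 1} = {1..<n}" using n by auto
  ultimately obtain c where c: "c (n - 1) = d" "\<forall>x\<in>{1..<n - 1}. c x \<in> L x"
    "proper_on (sq_adj n) {1..<n} c" by auto
  have "{y \<in> {1..<n}. sq_adj n 0 y} \<subseteq> {1, 2, n - 2, n - 1}"
    by (auto simp: sq_adj_def cyc_adj_def)
  then have "c ` {y \<in> {1..<n}. sq_adj n 0 y} \<inter> L 0 \<subseteq> {c 1, c 2, c (n - 2)}"
    using c(1) d(2) by blast
  then have "card (c ` {y \<in> {1..<n}. sq_adj n 0 y} \<inter> L 0) < card (L 0)"
    by (rule card_less_if_subset_three) (use L[of 0] n in auto)
  moreover have "0 \<notin> {1..<n}" by simp
  ultimately obtain a where a: "a \<in> L 0" "proper_on (sq_adj n) (insert 0 {1..<n}) (c(0 := a))"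
    using greedy_step[OF R c(3)] by blast
  have "insert 0 {1..<n} = {..<n}" using n by auto
  moreover have "c i \<in> L i" if "i < n" "i \<noteq> 0" for i
    using c d that by (cases "i = n - 1") auto
  ultimately show ?thesis using a by (intro exI[of _ "c(0 := a)"]) auto
qed

text \<open>Vertices \<open>0\<close> and \<open>3\<close> are common neighbours of \<open>1\<close>, so giving them the same colour leaves
  a free colour for \<open>1\<close>, which is coloured last.\<close>

lemma square_list_coloring_if_lists_meet:
  assumes n: "n \<ge> 6" and L: "\<And>i. i < n \<Longrightarrow> finite (L i) \<and> 4 \<le> card (L i)"
    and d: "d \<in> L 0" "d \<in> L 3"
  shows "\<exists>c. (\<forall>i<n. c i \<in> L i) \<and> proper_on (sq_adj n) {..<n} c"
proof -
  note R = symp_sq_adj[of n] irreflp_sq_adj[of n]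
  have "card {y \<in> {0, 3} \<union> {4..<x}. sq_adj n x y} < card (L x)" if "4 \<le> x" "x < n" for x
  proof -
    \<comment> \<open>Vertices \<open>1\<close> and \<open>2\<close> are still uncoloured, so
      \<open>0\<close> is the only possible wrap-around neighbour; \<open>3\<close> can occur only
      as \<open>x - 1\<close> or \<open>x - 2\<close>.\<close>
    have "{y \<in> {0, 3} \<union> {4..<x}. sq_adj n x y} \<subseteq> {x - 1, x - 2, 0}"
      using that by (auto simp: sq_adj_def cyc_adj_def)
    then show ?thesis by (rule card_less_if_subset_three) (use L[of x] that in auto)
  qed
  \<comment> \<open>For \<open>n = 5\<close> this would fail, as \<open>0\<close> and
    \<open>3\<close> are then at distance two.\<close>
  moreover have "proper_on (sq_adj n) {0, 3} (\<lambda>_. d)"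
    using n by (auto simp: proper_on_def sq_adj_def cyc_adj_def)
  ultimately have "\<exists>c'. (\<forall>x\<in>{0, 3}. c' x = d) \<and> (\<forall>x\<in>{4..<n}. c' x \<in> L x) \<and>
      proper_on (sq_adj n) ({0, 3} \<union> {4..<n}) c'"
    using L n by (intro greedy_interval R) auto
  then obtain c where c: "c 0 = d" "c 3 = d" "\<forall>x\<in>{4..<n}. c x \<in> L x"
    "proper_on (sq_adj n) ({0, 3} \<union> {4..<n}) c" by auto
  \<comment> \<open>The fourth neighbour of \<open>2\<close> is \<open>1\<close>, kept for
    last.\<close>
  have "{y \<in> {0, 3} \<union> {4..<n}. sq_adj n 2 y} \<subseteq> {0, 3, 4}"
    using n by (auto simp: sq_adj_def cyc_adj_def)
  then have "card {y \<in> {0, 3} \<union> {4..<n}. sq_adj n 2 y} < card (L 2)"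
    by (rule card_less_if_subset_three) (use L[of 2] n in auto)
  then have "card (c ` {y \<in> {0, 3} \<union> {4..<n}. sq_adj n 2 y} \<inter> L 2) < card (L 2)"
    using L[of 2] n by (intro card_image_Int_less) auto
  moreover have "2 \<notin> {0, 3} \<union> {4..<n}" by simp
  ultimately obtain a where a: "a \<in> L 2"
    "proper_on (sq_adj n) (insert 2 ({0, 3} \<union> {4..<n})) (c(2 := a))"
    using greedy_step[OF R c(4)] by blast
  have "insert 2 ({0, 3} \<union> {4..<n}) = {..<n} - {1}" using n by auto
  with a have a2: "proper_on (sq_adj n) ({..<n} - {1}) (c(2 := a))" by simp
  have "{y \<in> {..<n} - {1}. sq_adj n 1 y} \<subseteq> {0, 2, 3, n - 1}"
    using n by (auto simp: sq_adj_def cyc_adj_def)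
  then have "(c(2 := a)) ` {y \<in> {..<n} - {1}. sq_adj n 1 y} \<inter> L 1 \<subseteq> {d, a, c (n - 1)}"
    using c(1,2) by (auto split: if_splits)
  then have "card ((c(2 := a)) ` {y \<in> {..<n} - {1}. sq_adj n 1 y} \<inter> L 1) < card (L 1)"
    by (rule card_less_if_subset_three) (use L[of 1] n in auto)
  moreover have "1 \<notin> {..<n} - {1}" by simp
  ultimately obtain b where b: "b \<in> L 1"
    "proper_on (sq_adj n) (insert 1 ({..<n} - {1})) (c(2 := a, 1 := b))"
    using greedy_step[OF R a2] by blast
  have "insert 1 ({..<n} - {1}) = {..<n}" using n by auto
  moreover have "(c(2 := a, 1 := b)) i \<in> L i" if "i < n" for i
  proof -
    consider "i = 0" | "i = 1" | "i = 2" | "i = 3" | "4 \<le> i" by linarith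
    then show ?thesis using that a b c d by cases auto
  qed
  ultimately show ?thesis using b by (intro exI[of _ "c(2 := a, 1 := b)"]) auto
qed

section \<open>The cycle inside the graph\<close>

lemma is_cycle_rotate:
  assumes "is_cycle V E p"
  shows "is_cycle V E (rotate m p)"
proof -
  let ?n = "length p"
  have n: "?n > 0" using assms by (auto simp: is_cycle_def)
  have "{rotate m p ! i, rotate m p ! (Suc i mod ?n)} \<in> E" if "i < ?n" for i
  proof -
    have "{p ! ((m + i) mod ?n), p ! (Suc ((m + i) mod ?n) mod ?n)} \<in> E"
      using assms n by (simp add: is_cycle_def)
    moreover have "Suc ((m + i) mod ?n) mod ?n = (m + Suc i mod ?n) mod ?n"
      by (simp add: mod_simps)
    ultimately show ?thesis using that n by (simp add: nth_rotate)
  qed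
  then show ?thesis using assms by (simp add: is_cycle_def)
qed

text \<open>The index colourings single out the last vertex and its successor \<open>0\<close>;
  rotation brings any chosen cycle vertex into that position.\<close>

lemma is_cycle_rotate_to_last:
  assumes "is_cycle V E p" "i < length p"
  obtains q where "is_cycle V E q" "set q = set p" "length q = length p"
    "q ! (length p - 1) = p ! i" "q ! 0 = p ! (Suc i mod length p)"
proof
  let ?q = "rotate (Suc i) p"
  show "is_cycle V E ?q" by (rule is_cycle_rotate[OF assms(1)])
  have "Suc i + (length p - 1) = i + length p" using assms(2) by simp
  then have "(Suc i + (length p - 1)) mod length p = i" using assms(2) by (simp only: mod_add_self2 mod_less)
  moreover have "p \<noteq> []" using assms(2) by auto
  ultimately show "?q ! (length p - 1) = p ! i" "?q ! 0 = p ! (Suc i mod length p)"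
    by (simp_all add: nth_rotate del: rotate_Suc)
qed simp_all

lemma is_cycle_neighbors_last:
  assumes "is_cycle V E p" "n = length p"
  shows "p ! 0 \<in> neighbors E (p ! (n - 1))" "p ! (n - 2) \<in> neighbors E (p ! (n - 1))"
    "p ! 0 \<noteq> p ! (n - 2)"
proof -
  have n: "n \<ge> 3" and d: "distinct p"
    and e: "\<And>i. i < n \<Longrightarrow> {p ! i, p ! (Suc i mod n)} \<in> E"
    using assms by (auto simp: is_cycle_def)
  have "Suc (n - 1) = n" "Suc (n - 2) = n - 1" using n by auto
  then show "p ! 0 \<in> neighbors E (p ! (n - 1))" "p ! (n - 2) \<in> neighbors E (p ! (n - 1))"
    using e[of "n - 1"] e[of "n - 2"] n by (simp_all add: neighbors_def insert_commute)
  have "0 < n" "n - 2 < n" "n - 2 \<noteq> 0" using n by auto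
  with d assms(2) show "p ! 0 \<noteq> p ! (n - 2)" by (metis nth_eq_iff_index_eq)
qed

lemma card_cycle_edges:
  assumes "is_cycle V E p"
  shows "card ((\<lambda>i. {p ! i, p ! (Suc i mod length p)}) ` {..<length p}) = length p"
proof -
  have n: "length p \<ge> 3" and d: "distinct p" using assms by (auto simp: is_cycle_def)
  have "inj_on (\<lambda>i. {p ! i, p ! (Suc i mod length p)}) {..<length p}"
  proof (rule inj_onI)
    fix i j assume ij: "i \<in> {..<length p}" "j \<in> {..<length p}"
      and eq: "{p ! i, p ! (Suc i mod length p)} = {p ! j, p ! (Suc j mod length p)}"
    have lt: "Suc k mod length p < length p" for k using n by (intro mod_less_divisor) linarith
    \<comment> \<open>Distinct indices with the same edge would be cyclic successors of each other,
      impossible for order at least 3.\<close>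
    from eq have "i = j \<or> i = Suc j mod length p \<and> j = Suc i mod length p"
      using ij lt d by (auto simp: doubleton_eq_iff nth_eq_iff_index_eq)
    then show "i = j" using n ij by (auto simp: mod_Suc split: if_splits)
  qed
  then show ?thesis by (simp add: card_image)
qed

lemma cycle_edges_subset:
  assumes "is_cycle V E p"
  shows "(\<lambda>i. {p ! i, p ! (Suc i mod length p)}) ` {..<length p} \<subseteq> induced_edges E (set p)"
proof -
  have "Suc i mod length p < length p" for i
    using assms by (intro mod_less_divisor) (auto simp: is_cycle_def)
  then show ?thesis using assms by (auto simp: is_cycle_def induced_edges_def)
qed

text \<open>Starts the growth of \<open>S\<close> from the cycle: its own edges already match its
  vertices in number.\<close>

lemma card_induced_edges_cycle:
  assumes "simple_graph V E" "is_cycle V E p"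
  shows "card (set p) \<le> card (induced_edges E (set p))"
  using card_mono[OF finite_induced_edges[OF assms(1)] cycle_edges_subset[OF assms(2)]]
    card_cycle_edges[OF assms(2)] assms(2)
  by (simp add: is_cycle_def distinct_card)

text \<open>The \<open>n\<close> cycle edges exhaust the at most \<open>n\<close> edges induced on
  the cycle's vertices, so a chord would be one too many.\<close>

lemma unicyclic_cycle_chordless:
  assumes uni: "unicyclic V E" and p: "is_cycle V E p" and n: "n = length p"
    and ij: "i < n" "j < n" and e: "{p ! i, p ! j} \<in> E"
  shows "cyc_adj n i j"
proof -
  have simple: "simple_graph V E" using uni by (simp add: unicyclic_def)
  have n3: "n \<ge> 3" and d: "distinct p" and pV: "set p \<subseteq> V"
    using p n by (auto simp: is_cycle_def)
  let ?F = "(\<lambda>i. {p ! i, p ! (Suc i mod n)}) ` {..<n}"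
  have sub: "?F \<subseteq> induced_edges E (set p)"
    using cycle_edges_subset[OF p] n by simp
  have "set p \<noteq> {}" using n n3 by auto
  then have "card (induced_edges E (set p)) \<le> card ?F"
    using unicyclic_card_induced_edges_le[OF uni pV] card_cycle_edges[OF p] d n
    by (simp add: distinct_card)
  with sub have "?F = induced_edges E (set p)"
    by (intro card_seteq finite_induced_edges[OF simple])
  moreover have "{p ! i, p ! j} \<in> induced_edges E (set p)"
    using e ij n by (auto simp: induced_edges_def)
  ultimately obtain m where m: "m < n" "{p ! i, p ! j} = {p ! m, p ! (Suc m mod n)}" by blast
  have "Suc m mod n < n" using n3 by (intro mod_less_divisor) linarith
  then have "i = m \<and> j = Suc m mod n \<or> i = Suc m mod n \<and> j = m"
    using m ij d n by (auto simp: doubleton_eq_iff nth_eq_iff_index_eq)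
  moreover have "Suc m mod n = (if Suc m = n then 0 else Suc m)" using m(1) by simp
  ultimately show ?thesis using m(1) n3 by (auto simp: cyc_adj_def split: if_splits)
qed

section \<open>From index colourings to extendable colourings of the cycle\<close>

text \<open>Two ways to satisfy the invariant at a cycle vertex: distinct colours on its cycle
  neighbours make every neighbour count, or one colour from the cycle together with the off-cycle
  neighbours is enough.\<close>

lemma extendable_cycle:
  assumes uni: "unicyclic V E" and p: "is_cycle V E p" and n: "n = length p"
    and c: "\<And>i. i < n \<Longrightarrow> c i \<in> L (p ! i)" "proper_on (cyc_adj n) {..<n} c"
    and hue: "\<And>i. i < n \<Longrightarrow>
      (\<forall>a<n. \<forall>b<n. cyc_adj n i a \<longrightarrow> cyc_adj n i b \<longrightarrow> a \<noteq> b \<longrightarrow> c a \<noteq> c b) \<or>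
      min (degree E (p ! i)) r \<le> 1 + card (neighbors E (p ! i) - set p)"
  shows "\<exists>f. extendable E L r (set p) f"
proof -
  have simple: "simple_graph V E" using uni by (simp add: unicyclic_def)
  note fin = finite_neighbors[OF simple]
  have n3: "n \<ge> 3" and d: "distinct p" using p n by (auto simp: is_cycle_def)
  \<comment> \<open>Distinctness of \<open>p\<close> makes indexing injective, so \<open>f\<close>
    carries the colour of index \<open>i\<close> to the vertex \<open>p ! i\<close>.\<close>
  define f where "f v = c (inv_into {..<n} (nth p) v)" for v
  have "inj_on (nth p) {..<n}" using d n by (simp add: inj_on_nth)
  then have f: "f (p ! i) = c i" if "i < n" for i using that by (simp add: f_def)
  have idx: "\<exists>i<n. v = p ! i" if "v \<in> set p" for v using that n by (metis in_set_conv_nth)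
  have adj: "cyc_adj n i j" if "i < n" "j < n" "{p ! i, p ! j} \<in> E" for i j
    using unicyclic_cycle_chordless[OF uni p n that] .
  have "f u \<noteq> f v" if "u \<in> set p" "v \<in> set p" "{u, v} \<in> E" for u v
    using idx[OF that(1)] idx[OF that(2)] that(3) adj c(2) by (auto simp: f proper_on_def)
  moreover have "min (degree E v) r
      \<le> card (f ` (neighbors E v \<inter> set p)) + card (neighbors E v - set p)" if "v \<in> set p" for v
  proof -
    let ?N = "neighbors E v"
    obtain i where i: "i < n" "v = p ! i" using idx \<open>v \<in> set p\<close> by blast
    consider (inj) "\<forall>a<n. \<forall>b<n. cyc_adj n i a \<longrightarrow> cyc_adj n i b \<longrightarrow> a \<noteq> b \<longrightarrow> c a \<noteq> c b"
      | (slack) "min (degree E v) r \<le> 1 + card (?N - set p)"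
      using hue[OF i(1)] i(2) by blast
    then show ?thesis
    proof cases
      case inj
      have "inj_on f (?N \<inter> set p)"
      proof (rule inj_onI, rule ccontr)
        fix x y assume xy: "x \<in> ?N \<inter> set p" "y \<in> ?N \<inter> set p" "f x = f y" "x \<noteq> y"
        then obtain a b where ab: "a < n" "b < n" "x = p ! a" "y = p ! b" using idx by blast
        then have "cyc_adj n i a" "cyc_adj n i b"
          using xy i adj by (auto simp: neighbors_def insert_commute)
        with inj ab xy show False by (auto simp: f)
      qed
      then have "card (f ` (?N \<inter> set p)) = card (?N \<inter> set p)" by (rule card_image)
      moreover have "card ?N = card (?N \<inter> set p) + card (?N - set p)"
        using card_Un_disjoint[of "?N \<inter> set p" "?N - set p"] fin
        by (simp add: Int_Diff_Un Int_Diff_disjoint)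
      ultimately show ?thesis by (simp add: degree_def)
    next
      case slack
      have "{p ! i, p ! (Suc i mod n)} \<in> E" using p i(1) n by (simp add: is_cycle_def)
      then have "p ! (Suc i mod n) \<in> ?N" using i(2) by (simp add: neighbors_def insert_commute)
      moreover have "Suc i mod n < n" using n3 by (intro mod_less_divisor) linarith
      then have "p ! (Suc i mod n) \<in> set p" unfolding n by (rule nth_mem)
      ultimately have "p ! (Suc i mod n) \<in> ?N \<inter> set p" by blast
      then have "f ` (?N \<inter> set p) \<noteq> {}" by blast
      then have "1 \<le> card (f ` (?N \<inter> set p))" using fin by (simp add: Suc_le_eq card_gt_0_iff)
      with slack show ?thesis by linarith
    qed
  qed
  moreover have "f v \<in> L v" if "v \<in> set p" for v
    using idx[OF that] c(1) by (auto simp: f)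
  ultimately show ?thesis unfolding extendable_def by blast
qed

lemma extendable_cycle_if_square_coloring:
  assumes "unicyclic V E" "is_cycle V E p" "n = length p"
    and c: "\<forall>i<n. c i \<in> L (p ! i)" "proper_on (sq_adj n) {..<n} c"
  shows "\<exists>f. extendable E L r (set p) f"
proof (rule extendable_cycle[OF assms(1-3)])
  show "proper_on (cyc_adj n) {..<n} c" using c(2) by (auto simp: proper_on_def sq_adj_def)
  show "(\<forall>a<n. \<forall>b<n. cyc_adj n i a \<longrightarrow> cyc_adj n i b \<longrightarrow> a \<noteq> b \<longrightarrow> c a \<noteq> c b) \<or>
      min (degree E (p ! i)) r \<le> 1 + card (neighbors E (p ! i) - set p)" if "i < n" for i
    using c(2) sq_adj_if_common_neighbor[OF _ _ _ that] unfolding proper_on_def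
    by (meson lessThan_iff)
qed (use c in auto)

lemma extendable_cycle_if_lists_cover:
  assumes "unicyclic V E" "is_cycle V E p" "k_list V K L" "length p \<le> K"
  shows "\<exists>f. extendable E L r (set p) f"
proof -
  have "set p \<subseteq> V" using assms by (simp add: is_cycle_def)
  then have "finite (L (p ! i)) \<and> length p \<le> card (L (p ! i))" if "i < length p" for i
    using assms(3,4) nth_mem[OF that] by (auto simp: k_list_def)
  from list_coloring_large_lists[where L = "\<lambda>i. L (p ! i)", OF symp_sq_adj irreflp_sq_adj this]
  obtain c where "\<forall>i<length p. c i \<in> L (p ! i)" "proper_on (sq_adj (length p)) {..<length p} c"
    by blast
  then show ?thesis using extendable_cycle_if_square_coloring[OF assms(1,2) refl] by blast
qed

text \<open>Beyond order 4, either some list is not contained in the next one, or inclusion holds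
  all along the cycle and distant vertices share a colour. Each alternative saves one of the four
  colours at the vertex coloured last.\<close>

lemma extendable_cycle_not_five:
  assumes uni: "unicyclic V E" and p: "is_cycle V E p" and n: "length p \<noteq> 5"
    and L: "k_list V K L" and K: "4 \<le> K"
  shows "\<exists>f. extendable E L r (set p) f"
proof (cases "length p \<le> 4")
  case True
  then show ?thesis using extendable_cycle_if_lists_cover[OF uni p L] K by simp
next
  case False
  let ?n = "length p"
  have n6: "?n \<ge> 6" using False n by simp
  have lists: "finite (L (q ! i)) \<and> 4 \<le> card (L (q ! i))" if "is_cycle V E q" "i < length q" for q i
  proof -
    have "q ! i \<in> V" using that nth_mem[of i q] by (auto simp: is_cycle_def)
    then show ?thesis using L K by (simp add: k_list_def)
  qed
  show ?thesis
  proof (cases "\<exists>i<?n. \<not> L (p ! i) \<subseteq> L (p ! (Suc i mod ?n))")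
    case True
    then obtain i where i: "i < ?n" "\<not> L (p ! i) \<subseteq> L (p ! (Suc i mod ?n))" by blast
    obtain q where q: "is_cycle V E q" "set q = set p" "length q = ?n"
      "q ! (?n - 1) = p ! i" "q ! 0 = p ! (Suc i mod ?n)"
      using is_cycle_rotate_to_last[OF p i(1)] by blast
    obtain c where "\<forall>i<?n. c i \<in> L (q ! i)" "proper_on (sq_adj ?n) {..<?n} c"
      using square_list_coloring_if_lists_differ[where L = "\<lambda>i. L (q ! i)", OF n6] i q lists[OF q(1)]
      by auto
    then show ?thesis using extendable_cycle_if_square_coloring[OF uni q(1)] q by metis
  next
    case False
    have step: "L (p ! i) \<subseteq> L (p ! Suc i)" if "Suc i < ?n" for i
    proof -
      have "i < ?n" using that by simp
      with False have "L (p ! i) \<subseteq> L (p ! (Suc i mod ?n))" by blast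
      then show ?thesis using that by simp
    qed
    have "L (p ! 0) \<subseteq> L (p ! 3)"
      using step[of 0] step[of 1] step[of 2] n6 by (simp add: numeral_eq_Suc)
    moreover have "0 < ?n" using n6 by linarith
    then have "L (p ! 0) \<noteq> {}" using lists[OF p, of 0] by auto
    ultimately obtain d where d: "d \<in> L (p ! 0)" "d \<in> L (p ! 3)" by blast
    obtain c where "\<forall>i<?n. c i \<in> L (p ! i)" "proper_on (sq_adj ?n) {..<?n} c"
      using square_list_coloring_if_lists_meet[where L = "\<lambda>i. L (p ! i)", OF n6 _ d] lists[OF p]
      by auto
    then show ?thesis using extendable_cycle_if_square_coloring[OF uni p] by blast
  qed
qed

text \<open>With \<open>r = 1\<close> the hue requirement is at most 1, so a proper colouring of the
  cycle is enough.\<close>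

lemma extendable_cycle_one_hued:
  assumes uni: "unicyclic V E" and p: "is_cycle V E p" and L: "k_list V K L" and K: "3 \<le> K"
  shows "\<exists>f. extendable E L 1 (set p) f"
proof -
  let ?n = "length p"
  have pV: "set p \<subseteq> V" using p by (simp add: is_cycle_def)
  then have "finite (L (p ! i)) \<and> 3 \<le> card (L (p ! i))" if "i < ?n" for i
    using L K nth_mem[OF that] by (auto simp: k_list_def)
  from cycle_three_list_coloring[where L = "\<lambda>i. L (p ! i)", OF this]
  obtain c where "\<forall>i<?n. c i \<in> L (p ! i)" "proper_on (cyc_adj ?n) {..<?n} c" by blast
  then show ?thesis by (intro extendable_cycle[OF uni p refl, of c]) auto
qed

text \<open>A cycle vertex with a neighbour \<open>x\<close> off the cycle does not need its two cycle neighbours to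
  get distinct colours, since \<open>x\<close> will supply the second hue.\<close>

lemma extendable_cycle_two_hued:
  assumes uni: "unicyclic V E" and p: "is_cycle V E p" and L: "k_list V K L" and K: "4 \<le> K"
    and x: "x \<in> neighbors E (p ! (length p - 1))" "x \<notin> set p"
  shows "\<exists>f. extendable E L 2 (set p) f"
proof (cases "length p \<le> 4")
  case True
  then show ?thesis using extendable_cycle_if_lists_cover[OF uni p L] K by simp
next
  case False
  define n where "n = length p"
  have n5: "n \<ge> 5" using False by (simp add: n_def)
  have simple: "simple_graph V E" using uni by (simp add: unicyclic_def)
  have pV: "set p \<subseteq> V" using p by (simp add: is_cycle_def)
  have lists: "finite (L (p ! i)) \<and> 4 \<le> card (L (p ! i))" if "i < n" for i
  proof -
    have "p ! i \<in> V" using pV nth_mem[of i p] that unfolding n_def by blast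
    then show ?thesis using L K by (simp add: k_list_def)
  qed
  obtain c where c: "\<forall>i<n. c i \<in> L (p ! i)"
    "proper_on (\<lambda>i j. sq_adj n i j \<and> {i, j} \<noteq> {0, n - 2}) {..<n} c"
    using relaxed_four_list_coloring[where L = "\<lambda>i. L (p ! i)", OF n5 lists] by blast
  have cR: "c a \<noteq> c b" if "a < n" "b < n" "sq_adj n a b" "{a, b} \<noteq> {0, n - 2}" for a b
    using c(2)[unfolded proper_on_def, THEN bspec, THEN bspec, of a b] that by simp
  show ?thesis
  proof (rule extendable_cycle[OF uni p n_def])
    have "{i, j} \<noteq> {0, n - 2}" if "cyc_adj n i j" for i j
      using that n5 by (auto simp: cyc_adj_def doubleton_eq_iff)
    then show "proper_on (cyc_adj n) {..<n} c"
      using cR unfolding proper_on_def sq_adj_def by simp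
    show "(\<forall>a<n. \<forall>b<n. cyc_adj n i a \<longrightarrow> cyc_adj n i b \<longrightarrow> a \<noteq> b \<longrightarrow> c a \<noteq> c b) \<or>
      min (degree E (p ! i)) 2 \<le> 1 + card (neighbors E (p ! i) - set p)" if i: "i < n" for i
    proof (cases "i = n - 1")
      case True
      then have "x \<in> neighbors E (p ! i) - set p" using x by (simp add: n_def)
      then have "1 \<le> card (neighbors E (p ! i) - set p)"
        using finite_neighbors[OF simple] by (auto simp: Suc_le_eq card_gt_0_iff)
      then have "min (degree E (p ! i)) 2 \<le> 1 + card (neighbors E (p ! i) - set p)" by linarith
      then show ?thesis ..
    next
      case False
      \<comment> \<open>For \<open>n \<ge> 5\<close> the last vertex is the only common cycle
        neighbour of \<open>0\<close> and \<open>n - 2\<close>; for \<open>n = 4\<close> vertex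
        \<open>1\<close> would be another.\<close>
      have "\<not> (cyc_adj n i 0 \<and> cyc_adj n i (n - 2))"
        using False n5 i by (auto simp: cyc_adj_def)
      then have "{a, b} \<noteq> {0, n - 2}" if "cyc_adj n i a" "cyc_adj n i b" for a b
        using that by (metis doubleton_eq_iff)
      then have "c a \<noteq> c b" if "a < n" "b < n" "cyc_adj n i a" "cyc_adj n i b" "a \<noteq> b" for a b
        using that by (intro cR sq_adj_if_common_neighbor[OF that(3-5) i that(1,2)])
      then show ?thesis by simp
    qed
    show "c i \<in> L (p ! i)" if "i < n" for i using c(1) that by simp
  qed
qed

section \<open>Off-cycle attachment, maximum degree and the lower bound\<close>

text \<open>Cycle vertices have degree at least 2, so a vertex of degree 1 lies off the cycle and
  connectedness gives an edge leaving the cycle. Its cycle end \<open>w\<close> is rotated to the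
  last position.\<close>

lemma unicyclic_cycle_with_attachment:
  assumes uni: "unicyclic V E" and min: "min_degree V E = 1" and p: "is_cycle V E p"
  obtains q x where "is_cycle V E q" "set q = set p" "length q = length p"
    "x \<in> neighbors E (q ! (length q - 1))" "x \<notin> set q"
proof -
  have simple: "simple_graph V E" and conn: "connected_graph V E"
    using uni by (simp_all add: unicyclic_def)
  have "finite V" "V \<noteq> {}" using simple conn by (auto simp: simple_graph_def connected_graph_def)
  then have "min_degree V E \<in> degree E ` V" unfolding min_degree_def by (intro Min_in) auto
  then obtain v where v: "v \<in> V" "degree E v = 1" using min by auto
  have pV: "set p \<subseteq> V" and pn: "set p \<noteq> {}" using p by (auto simp: is_cycle_def)
  have "v \<notin> set p"
  proof
    assume "v \<in> set p"
    then obtain i where i: "i < length p" "p ! i = v" by (metis in_set_conv_nth)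
    obtain q where q: "is_cycle V E q" "length q = length p" "q ! (length p - 1) = v"
      using is_cycle_rotate_to_last[OF p i(1)] i(2) by blast
    note nb = is_cycle_neighbors_last[OF q(1) refl]
    have "{q ! 0, q ! (length p - 2)} \<subseteq> neighbors E v" using nb q by simp
    then have "card {q ! 0, q ! (length p - 2)} \<le> degree E v"
      unfolding degree_def by (intro card_mono finite_neighbors[OF simple])
    then show False using nb(3) q v by simp
  qed
  then have "set p \<subset> V" using pV v by blast
  then obtain w x where wx: "w \<in> set p" "x \<in> V - set p" "{w, x} \<in> E"
    using connected_graph_boundary[OF simple conn _ pn] by blast
  then obtain i where i: "i < length p" "p ! i = w" by (metis in_set_conv_nth)
  obtain q where q: "is_cycle V E q" "set q = set p" "length q = length p"
    "q ! (length p - 1) = w"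
    using is_cycle_rotate_to_last[OF p i(1)] i(2) by blast
  have "x \<in> neighbors E (q ! (length q - 1))"
    using wx q by (simp add: neighbors_def insert_commute)
  then show thesis using that[OF q(1-3)] q wx by blast
qed

text \<open>The last vertex has two cycle neighbours besides \<open>x\<close>. This turns
  assumptions on \<open>r\<close> into lower bounds on the number of available colours.\<close>

lemma max_degree_ge_3:
  assumes simple: "simple_graph V E" and q: "is_cycle V E q"
    and x: "x \<in> neighbors E (q ! (length q - 1))" "x \<notin> set q"
  shows "3 \<le> max_degree V E"
proof -
  let ?n = "length q"
  have n: "?n \<ge> 3" and qV: "set q \<subseteq> V" using q by (auto simp: is_cycle_def)
  note nb = is_cycle_neighbors_last[OF q refl]
  have "q ! i \<in> set q" if "i < ?n" for i using that by simp
  from this[of 0] this[of "?n - 2"] have "q ! 0 \<in> set q" "q ! (?n - 2) \<in> set q"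
    using n by linarith+
  then have "3 = card {x, q ! 0, q ! (?n - 2)}" using nb(3) x(2) by (auto simp: card_insert_if)
  also have "\<dots> \<le> degree E (q ! (?n - 1))"
    unfolding degree_def using nb x by (intro card_mono finite_neighbors[OF simple]) auto
  also have "\<dots> \<le> max_degree V E"
    using n nth_mem[of "?n - 1" q] qV by (intro degree_le_max_degree[OF simple]) auto
  finally show ?thesis .
qed

text \<open>Give every vertex the list \<open>{..<k}\<close>: a vertex of maximum degree must see
  \<open>min r \<Delta>\<close> colours, all different from its own.\<close>

lemma hued_list_coloring_lower_bound:
  assumes simple: "simple_graph V E" and "V \<noteq> {}"
    and col: "\<And>L. k_list V k L \<Longrightarrow> \<exists>c. hued_list_coloring V E L r c"
  shows "min r (max_degree V E) + 1 \<le> k"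
proof -
  have "finite V" using simple by (simp add: simple_graph_def)
  then have "max_degree V E \<in> degree E ` V"
    unfolding max_degree_def using assms(2) by (intro Max_in) auto
  then obtain v where v: "v \<in> V" "degree E v = max_degree V E" by auto
  obtain c where c: "hued_list_coloring V E (\<lambda>_. {..<k}) r c"
    using col[of "\<lambda>_. {..<k}"] by (auto simp: k_list_def)
  let ?A = "c ` neighbors E v"
  have "insert (c v) ?A \<subseteq> {..<k}"
    using c v neighbors_subset[OF simple, of v] by (auto simp: hued_list_coloring_def)
  then have "card (insert (c v) ?A) \<le> k" using card_mono[of "{..<k}"] by fastforce
  moreover have "c u \<noteq> c v" if "u \<in> neighbors E v" for u
    using c that by (simp add: hued_list_coloring_def neighbors_def)
  then have "c v \<notin> ?A" by force
  then have "card (insert (c v) ?A) = Suc (card ?A)"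
    using finite_neighbors[OF simple] by simp
  moreover have "min (max_degree V E) r \<le> card ?A"
    using c v by (auto simp: hued_list_coloring_def)
  ultimately show ?thesis by linarith
qed

theorem theorem1p7:
  fixes V :: "'a set" and E :: "'a set set" and C :: "'a list" and r n k :: nat
  assumes "r \<ge> 1"
    and "unicyclic V E"
    and "min_degree V E = 1"
    and "is_cycle V E C"
    and "n = length C"
    and "n \<ge> 3"
    and "k = min r (max_degree V E) + 1"
  shows "(n \<noteq> 5 \<and> r \<ge> 3 \<longrightarrow> list_hued_chromatic_number V E r = k) \<and>
         (n = 5 \<or> r = 2 \<longrightarrow> list_hued_chromatic_number V E r \<in> {k, k + 1})"
proof -
  have simple: "simple_graph V E" and "V \<noteq> {}"
    using assms(2) by (auto simp: unicyclic_def connected_graph_def)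
  obtain q x where q: "is_cycle V E q" "set q = set C" "length q = n"
    and x: "x \<in> neighbors E (q ! (length q - 1))" "x \<notin> set q"
    using unicyclic_cycle_with_attachment[OF assms(2-4)] assms(5) by metis
  have deg: "3 \<le> max_degree V E" by (rule max_degree_ge_3[OF simple q(1) x])
  define P where "P K \<longleftrightarrow> (\<forall>L. k_list V K L \<longrightarrow> (\<exists>c. hued_list_coloring V E L r c))" for K
  have chi: "list_hued_chromatic_number V E r = (LEAST K. P K)"
    by (simp add: list_hued_chromatic_number_def P_def)
  have lower: "k \<le> K" if "P K" for K
    using hued_list_coloring_lower_bound[OF simple \<open>V \<noteq> {}\<close>] that assms(7) by (simp add: P_def)
  have qV: "set q \<subseteq> V" "set q \<noteq> {}" using q(1) by (auto simp: is_cycle_def)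
  \<comment> \<open>The rest of the graph never needs more than \<open>k\<close> colours, so only
    the cycle has to be coloured.\<close>
  have upper: "P K" if "k \<le> K" "\<And>L. k_list V K L \<Longrightarrow> \<exists>c. extendable E L r (set q) c" for K
    unfolding P_def
    using extendable_imp_hued_list_coloring[OF assms(2) qV card_induced_edges_cycle[OF simple q(1)]
        assms(1)] that assms(7) by (metis Suc_eq_plus1 Suc_le_eq)
  have "list_hued_chromatic_number V E r = k" if "n \<noteq> 5" "r \<ge> 3"
  proof -
    have "4 \<le> k" using that deg assms(7) by simp
    then have "P k"
      using extendable_cycle_not_five[OF assms(2) q(1)] q(3) that by (intro upper) auto
    then show ?thesis unfolding chi using lower by (intro Least_equality)
  qed
  moreover have "list_hued_chromatic_number V E r \<in> {k, k + 1}" if "n = 5 \<or> r = 2"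
  proof -
    have "\<exists>c. extendable E L r (set q) c" if L: "k_list V (k + 1) L" for L
    proof -
      \<comment> \<open>The case \<open>r = 1\<close> arises because \<open>n = 5\<close> puts no
        bound on \<open>r\<close>.\<close>
      consider "r = 1" | "r = 2" | "n = 5" "r \<ge> 3" using \<open>n = 5 \<or> r = 2\<close> assms(1) by linarith
      then show ?thesis
      proof cases
        case 1
        then have "3 \<le> k + 1" using deg assms(7) by simp
        with 1 show ?thesis using extendable_cycle_one_hued[OF assms(2) q(1) L] by simp
      next
        case 2
        \<comment> \<open>Here \<open>k = 3\<close>, so the fourth colour comes from the extra
          one.\<close>
        then have "4 \<le> k + 1" using deg assms(7) by simp
        with 2 show ?thesis using extendable_cycle_two_hued[OF assms(2) q(1) L _ x] by simp
      next
        case 3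
        then have "length q \<le> k + 1" using deg assms(7) q(3) by simp
        then show ?thesis by (rule extendable_cycle_if_lists_cover[OF assms(2) q(1) L])
      qed
    qed
    then have "P (k + 1)" by (intro upper) auto
    \<comment> \<open>\<open>P (k + 1)\<close> also guarantees that the least value satisfies
      \<open>P\<close>, so the lower bound applies to it.\<close>
    then have "(LEAST K. P K) \<le> k + 1" "P (LEAST K. P K)" by (auto intro: Least_le LeastI)
    then show ?thesis unfolding chi using lower[of "LEAST K. P K"] by auto
  qed
  ultimately show ?thesis by blast
qed

end
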